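(* Let $\mathcal{L}=(L,\wedge,\vee,0,1)$ be a complete lattice, let $X\subseteq L\setminus\{1\}$, and consider the topological space $(X,\tau^{cl})$. If $\mathcal{C}(\mathcal{L})$ satisfies the complete max property, then the following conditions are equivalent: (1) $Max(X)=X=Min(X)$; (2) $X$ is $T_2$; (3) $X$ is $T_1$; (4) $X$ is discrete.
   Context: For $a\in L$ put $V(a)=\{p\in X\mid a\le p\}$. The classical Zariski topology $\tau^{cl}$ on $X$ is the topology having $\{X\setminus V(a)\mid a\in L\}$ as a subbase. For $a\in L$ put $\sqrt a=\bigwedge_{p\in V(a)}p$ (empty meet equal to $1$), and $\mathcal{C}(L)=\{a\in L\mid\sqrt a=a\}$. With the induced order, $\mathcal{C}(\mathcal{L})=(\mathcal{C}(L),\wedge,\tilde\vee,\sqrt0,1)$ is a complete lattice whose meets are those of $L$ and whose joins are $\tilde\bigvee Y=\sqrt{\bigvee Y}$. $Max(X)$ and $Min(X)$ are the sets of maximal and minimal elements of the poset $X$. For a complete lattice $\mathcal{K}$ with top $1$ and underlying set $K$, $Max(\mathcal{K})$ is the set of maximal elements of $K\setminus\{1\}$; $\mathcal{K}$ satisfies the complete max property iff $\bigwedge_{p\in Max(\mathcal{K})\setminus\{q\}}p\nleq q$ for every $q\in Max(\mathcal{K})$. *)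

theory Defs
  imports "HOL-Analysis.T1_Spaces" "HOL-Algebra.Complete_Lattice"
begin

definition vset :: "('a, 'b) gorder_scheme \<Rightarrow> 'a set \<Rightarrow> 'a \<Rightarrow> 'a set"
  where "vset L X a = {p \<in> X. a \<sqsubseteq>\<^bsub>L\<^esub> p}"

text \<open>The carrier is the union of the subbase. It equals \<open>X\<close> as soon as \<open>L\<close> has a top element
  that is not in \<open>X\<close>, because the top has an empty \<open>vset\<close>.\<close>

definition zariski_topology :: "('a, 'b) gorder_scheme \<Rightarrow> 'a set \<Rightarrow> 'a topology"
  where "zariski_topology L X = topology_generated_by {X - vset L X a | a. a \<in> carrier L}"

definition radical :: "('a, 'b) gorder_scheme \<Rightarrow> 'a set \<Rightarrow> 'a \<Rightarrow> 'a"
  where "radical L X a = \<Sqinter>\<^bsub>L\<^esub> (vset L X a)"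

text \<open>Only the carrier is changed, so the order is the induced one. The meets and the top of this
  structure are taken in the restricted carrier; for a complete lattice \<open>L\<close> and \<open>X\<close> contained in
  its carrier they coincide with those of \<open>L\<close>.\<close>

definition radical_lattice :: "('a, 'b) gorder_scheme \<Rightarrow> 'a set \<Rightarrow> ('a, 'b) gorder_scheme"
  where "radical_lattice L X = L\<lparr>carrier := {a \<in> carrier L. radical L X a = a}\<rparr>"

definition maximal_elements :: "('a, 'b) gorder_scheme \<Rightarrow> 'a set \<Rightarrow> 'a set"
  where "maximal_elements L A = {m \<in> A. \<forall>x\<in>A. m \<sqsubseteq>\<^bsub>L\<^esub> x \<longrightarrow> x = m}"

definition minimal_elements :: "('a, 'b) gorder_scheme \<Rightarrow> 'a set \<Rightarrow> 'a set"
  where "minimal_elements L A = {m \<in> A. \<forall>x\<in>A. x \<sqsubseteq>\<^bsub>L\<^esub> m \<longrightarrow> x = m}"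

definition lattice_Max :: "('a, 'b) gorder_scheme \<Rightarrow> 'a set"
  where "lattice_Max K = maximal_elements K (carrier K - {\<top>\<^bsub>K\<^esub>})"

definition complete_max_property :: "('a, 'b) gorder_scheme \<Rightarrow> bool"
  where "complete_max_property K \<longleftrightarrow>
    (\<forall>q \<in> lattice_Max K. \<not> \<Sqinter>\<^bsub>K\<^esub> (lattice_Max K - {q}) \<sqsubseteq>\<^bsub>K\<^esub> q)"

end

theory Submission
  imports Defs
begin

text \<open>
  Every open set of the Zariski topology is downward closed, since a subbasic set
  \<open>X - vset L X a\<close> consists of the points that do not lie above \<open>a\<close>. Points
  \<open>p \<sqsubseteq> q\<close> therefore cannot be separated by an open set around \<open>q\<close>, and a \<open>T\<^sub>1\<close> space
  has to be an antichain; to be an antichain is the same as \<open>Max(X) = X = Min(X)\<close>.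

  The complete max property closes the cycle of implications by giving discreteness of an
  antichain. The fixed points of the radical are exactly the meets of subsets of \<open>X\<close>, so the
  maximal elements of the radical lattice below its top are the maximal elements of \<open>X\<close>
  (\<open>lattice_Max_radical_lattice\<close>). If \<open>X\<close> is an antichain these are all points of \<open>X\<close>, and the
  property says that the meet \<open>b\<close> of all points other than \<open>q\<close> is not below \<open>q\<close>. Hence
  \<open>vset L X b = X - {q}\<close>, and \<open>{q}\<close> is subbasic open. The remaining implications, from
  discrete to \<open>T\<^sub>2\<close> to \<open>T\<^sub>1\<close>, hold in every space.
\<close>

lemma maximal_minimal_elements_iff_antichain:
  "maximal_elements L X = X \<and> X = minimal_elements L X
    \<longleftrightarrow> (\<forall>p\<in>X. \<forall>q\<in>X. p \<sqsubseteq>\<^bsub>L\<^esub> q \<longrightarrow> p = q)"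
  unfolding maximal_elements_def minimal_elements_def by blast

lemma openin_zariski_downward_closed:
  assumes "openin (zariski_topology L X) U" "q \<in> U"
    and "partial_order L" "p \<in> X" "X \<subseteq> carrier L" "p \<sqsubseteq>\<^bsub>L\<^esub> q"
  shows "p \<in> U"
proof -
  interpret partial_order L by fact
  have "generate_topology_on {X - vset L X a |a. a \<in> carrier L} U"
    using assms(1) unfolding zariski_topology_def by (rule openin_topology_generated_by)
  then show ?thesis
    using assms(2)
  proof induction
    case (Basis S)
    then show ?case
      using assms(4-6) by (auto simp: vset_def intro: le_trans)
  qed auto
qed

context complete_lattice
begin

text \<open>This makes all of \<open>X\<close> a subbasic open set, and the top, as an empty meet, a fixed point of
  the radical.\<close>

lemma vset_top:
  assumes "X \<subseteq> carrier L - {\<top>}"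
  shows "vset L X \<top> = {}"
proof -
  have "p = \<top>" if "p \<in> carrier L" "\<top> \<sqsubseteq> p" for p
    using that by (intro le_antisym) auto
  then show ?thesis
    using assms by (auto simp: vset_def)
qed

lemma topspace_zariski:
  assumes "X \<subseteq> carrier L - {\<top>}"
  shows "topspace (zariski_topology L X) = X"
  using vset_top[OF assms] top_closed
  unfolding zariski_topology_def topology_generated_by_topspace by blast

lemma radical_inf_subset:
  assumes "X \<subseteq> carrier L" "Y \<subseteq> X"
  shows "radical L X (\<Sqinter>Y) = \<Sqinter>Y"
proof -
  have Y: "Y \<subseteq> carrier L" and V: "vset L X (\<Sqinter>Y) \<subseteq> carrier L"
    using assms by (auto simp: vset_def)
  have "Y \<subseteq> vset L X (\<Sqinter>Y)"
    using assms Y by (auto simp: vset_def intro: inf_lower)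
  then have "\<Sqinter>(vset L X (\<Sqinter>Y)) \<sqsubseteq> \<Sqinter>Y"
    using Y V by (intro inf_greatest) (auto intro: inf_lower)
  moreover have "\<Sqinter>Y \<sqsubseteq> \<Sqinter>(vset L X (\<Sqinter>Y))"
    using Y V by (intro inf_greatest) (auto simp: vset_def)
  ultimately show ?thesis
    unfolding radical_def using Y V by (intro le_antisym) auto
qed

lemma point_radical:
  assumes "X \<subseteq> carrier L" "p \<in> X"
  shows "radical L X p = p"
proof -
  have "\<Sqinter>{p} = p"
    using assms by (intro inf_of_singleton) auto
  then show ?thesis
    using radical_inf_subset[of X "{p}"] assms by auto
qed

lemma radical_lattice_simps:
  "carrier (radical_lattice L X) = {a \<in> carrier L. radical L X a = a}"
  "x \<sqsubseteq>\<^bsub>radical_lattice L X\<^esub> y \<longleftrightarrow> x \<sqsubseteq> y"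
  by (simp_all add: radical_lattice_def)

lemma greatest_radical_lattice_unique:
  assumes "greatest (radical_lattice L X) x A" "greatest (radical_lattice L X) y A"
  shows "x = y"
  using assms by (auto simp: greatest_def radical_lattice_simps intro!: le_antisym)

text \<open>The meet of \<open>Y\<close> in \<open>L\<close> is itself a fixed point of the radical, so restricting the carrier
  does not change which element is the greatest lower bound.\<close>

lemma radical_lattice_inf:
  assumes "X \<subseteq> carrier L" "Y \<subseteq> X"
  shows "\<Sqinter>\<^bsub>radical_lattice L X\<^esub> Y = \<Sqinter>Y"
proof -
  have Y: "Y \<subseteq> carrier L" "Y \<subseteq> carrier (radical_lattice L X)"
    using assms point_radical by (auto simp: radical_lattice_simps)
  have "greatest (radical_lattice L X) (\<Sqinter>Y) (Lower (radical_lattice L X) Y)"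
  proof (rule greatest_LowerI)
    show "\<Sqinter>Y \<sqsubseteq>\<^bsub>radical_lattice L X\<^esub> y" if "y \<in> Y" for y
      using that Y(1) by (simp add: radical_lattice_simps inf_lower)
    show "z \<sqsubseteq>\<^bsub>radical_lattice L X\<^esub> \<Sqinter>Y" if "z \<in> Lower (radical_lattice L X) Y" for z
      using that Y unfolding radical_lattice_simps
      by (intro inf_greatest) (auto simp: Lower_def radical_lattice_simps)
    show "\<Sqinter>Y \<in> carrier (radical_lattice L X)"
      using radical_inf_subset[OF assms] Y(1) by (simp add: radical_lattice_simps)
  qed (rule Y(2))
  then show ?thesis
    unfolding inf_def[of "radical_lattice L X"]
    by (intro some_equality) (auto intro: greatest_radical_lattice_unique)
qed

lemma radical_lattice_top:
  assumes "X \<subseteq> carrier L - {\<top>}"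
  shows "\<top>\<^bsub>radical_lattice L X\<^esub> = \<top>"
proof -
  have "\<Sqinter>{} = \<top>"
    using weak_inf_empty by (simp add: eq_is_equal)
  then have "radical L X \<top> = \<top>"
    by (simp add: radical_def vset_top[OF assms])
  then have "greatest (radical_lattice L X) \<top> (carrier (radical_lattice L X))"
    by (auto simp: greatest_def radical_lattice_simps)
  then show ?thesis
    unfolding top_def[of "radical_lattice L X"]
    by (intro some_equality) (auto intro: greatest_radical_lattice_unique)
qed

text \<open>The radical of \<open>a\<close> is the top as soon as \<open>vset L X a\<close> is empty, by the convention on the
  empty meet. A fixed point other than the top therefore lies below some point of \<open>X\<close>.\<close>

lemma radical_element_below_point:
  assumes "radical L X a = a" "a \<noteq> \<top>"
  obtains p where "p \<in> X" "a \<sqsubseteq> p"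
proof -
  have "\<Sqinter>{} = \<top>"
    using weak_inf_empty by (simp add: eq_is_equal)
  then have "vset L X a \<noteq> {}"
    using assms by (metis radical_def)
  then show thesis
    using that by (auto simp: vset_def)
qed

text \<open>Since the points of \<open>X\<close> are fixed points of the radical, and cofinal among the fixed points
  other than the top, both sets have the same maximal elements.\<close>

lemma lattice_Max_radical_lattice:
  assumes "X \<subseteq> carrier L - {\<top>}"
  shows "lattice_Max (radical_lattice L X) = maximal_elements L X"
proof -
  define C where "C = {a \<in> carrier L. radical L X a = a} - {\<top>}"
  have C: "C \<subseteq> carrier L" and X: "X \<subseteq> C"
    using assms point_radical[of X] by (auto simp: C_def)
  have cofinal: "\<exists>p\<in>X. a \<sqsubseteq> p" if "a \<in> C" for a
    using that by (auto simp: C_def elim: radical_element_below_point)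
  have "maximal_elements L C = maximal_elements L X"
  proof (intro equalityI subsetI)
    fix m assume "m \<in> maximal_elements L C"
    then show "m \<in> maximal_elements L X"
      using cofinal X unfolding maximal_elements_def by blast
  next
    fix m assume "m \<in> maximal_elements L X"
    then have m: "m \<in> X" and m_max: "\<And>p. \<lbrakk>p \<in> X; m \<sqsubseteq> p\<rbrakk> \<Longrightarrow> p = m"
      unfolding maximal_elements_def by blast+
    have "a = m" if a: "a \<in> C" "m \<sqsubseteq> a" for a
    proof -
      obtain p where p: "p \<in> X" "a \<sqsubseteq> p"
        using cofinal[OF a(1)] by blast
      have carr: "m \<in> carrier L" "a \<in> carrier L" "p \<in> carrier L"
        using m a(1) p(1) X C by auto
      then have "m \<sqsubseteq> p"
        using a(2) p(2) by (blast intro: le_trans)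
      then have "p = m"
        using m_max p(1) by blast
      then show ?thesis
        using a(2) p(2) carr by (blast intro: le_antisym)
    qed
    then show "m \<in> maximal_elements L C"
      using m X unfolding maximal_elements_def by blast
  qed
  then show ?thesis
    by (simp add: lattice_Max_def maximal_elements_def radical_lattice_simps
        radical_lattice_top[OF assms] C_def)
qed

text \<open>The complement of \<open>{q}\<close> is the \<open>vset\<close> of the meet of all other points: the complete max
  property is exactly what keeps \<open>q\<close> itself out of it.\<close>

lemma antichain_imp_zariski_discrete:
  assumes X: "X \<subseteq> carrier L - {\<top>}"
    and cmp: "complete_max_property (radical_lattice L X)"
    and antichain: "\<And>p q. \<lbrakk>p \<in> X; q \<in> X; p \<sqsubseteq> q\<rbrakk> \<Longrightarrow> p = q"
  shows "zariski_topology L X = discrete_topology X"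
proof -
  have XL: "X \<subseteq> carrier L"
    using X by auto
  have Max: "lattice_Max (radical_lattice L X) = X"
    using antichain by (auto simp: lattice_Max_radical_lattice[OF X] maximal_elements_def)
  have "openin (zariski_topology L X) {q}" if q: "q \<in> X" for q
  proof -
    define b where "b = \<Sqinter>(X - {q})"
    have b: "b \<in> carrier L"
      unfolding b_def using XL by (intro inf_closed) auto
    have "b \<sqsubseteq> p" if "p \<in> X - {q}" for p
      using that XL unfolding b_def by (intro inf_lower) auto
    moreover have "\<not> b \<sqsubseteq> q"
      using cmp q XL
      by (simp add: complete_max_property_def Max radical_lattice_simps radical_lattice_inf b_def)
    ultimately have "{q} = X - vset L X b"
      using q by (auto simp: vset_def)
    then show ?thesis
      using b unfolding zariski_topology_def by (intro topology_generated_by_Basis) auto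
  qed
  then have "discrete_topology X = zariski_topology L X"
    by (simp add: discrete_topology_unique topspace_zariski[OF X])
  then show ?thesis ..
qed

lemma t1_zariski_imp_antichain:
  assumes X: "X \<subseteq> carrier L - {\<top>}"
    and "t1_space (zariski_topology L X)"
    and "p \<in> X" "q \<in> X" "p \<sqsubseteq> q"
  shows "p = q"
proof (rule ccontr)
  assume "p \<noteq> q"
  then obtain U where "openin (zariski_topology L X) U" "q \<in> U" "p \<notin> U"
    using assms(2-4) unfolding t1_space_def topspace_zariski[OF X] by metis
  moreover have "X \<subseteq> carrier L"
    using X by auto
  ultimately show False
    using openin_zariski_downward_closed assms(3,5) partial_order_axioms by metis
qed

end

theorem corollary1p28:
  fixes L :: "('a, 'b) gorder_scheme" and X :: "'a set"
  assumes "complete_lattice L"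
    and "X \<subseteq> carrier L - {\<top>\<^bsub>L\<^esub>}"
    and "complete_max_property (radical_lattice L X)"
  shows "((maximal_elements L X = X \<and> X = minimal_elements L X) \<longleftrightarrow> Hausdorff_space (zariski_topology L X))
    \<and> (Hausdorff_space (zariski_topology L X) \<longleftrightarrow> t1_space (zariski_topology L X))
    \<and> (t1_space (zariski_topology L X) \<longleftrightarrow> zariski_topology L X = discrete_topology X)"
proof -
  interpret complete_lattice L by fact
  have "zariski_topology L X = discrete_topology X"
    if "maximal_elements L X = X \<and> X = minimal_elements L X"
    using that antichain_imp_zariski_discrete[OF assms(2,3)]
    unfolding maximal_minimal_elements_iff_antichain by blast
  moreover have "Hausdorff_space (zariski_topology L X)"
    if "zariski_topology L X = discrete_topology X"
    unfolding that by simp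
  moreover have "t1_space (zariski_topology L X)" if "Hausdorff_space (zariski_topology L X)"
    using that by (rule Hausdorff_imp_t1_space)
  moreover have "maximal_elements L X = X \<and> X = minimal_elements L X"
    if "t1_space (zariski_topology L X)"
    using t1_zariski_imp_antichain[OF assms(2) that]
    unfolding maximal_minimal_elements_iff_antichain by blast
  ultimately show ?thesis
    by blast
qed

end
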